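(* If $p<1/2$, then the sequence $X_N$ converges in distribution, as $N\to\infty$, to some non-trivial random variable.
   Context: Let $p\in[0,1]$. For $N\ge 1$ let $\mathcal T$ be the full binary tree of depth $N$, where depth is counted so that the tree of depth $1$ is a single vertex (which is both root and leaf) and the root of the tree of depth $N+1$ has two children, each the root of a full binary tree of depth $N$. Let $\{\eta_v\}_{v\in\mathcal T}$ be independent random variables with $\mathbb P(\eta_v=1)=1-\mathbb P(\eta_v=-1)=p$. Define $X_v$ recursively from the leaves: $X_v=1$ if $v$ is a leaf; if $w$ has children $v_1,v_2$, then $X_w=X_{v_1}+X_{v_2}$ if $\eta_w=1$ and $X_w=\min(X_{v_1},X_{v_2})$ if $\eta_w=-1$. Set $X_N:=X_{root}$.
   Formalization: Non-triviality (the limit not being almost surely constant) is claimed only for 0 < p < 1/2, since at p = 0 every X_N equals 1 almost surely and the limit is constant; convergence in distribution to a finite random variable is proved for all 0 ≤ p < 1/2. *)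

theory Defs
  imports "HOL-Probability.Probability"
begin

(* A vertex is the path from the root to it: the root is [], and the children of v are
   v @ [False] and v @ [True].  A tree of depth 1 is a single vertex. *)
definition full_tree :: "nat \<Rightarrow> bool list set" where
  "full_tree N = {v. length v < N}"

definition is_leaf :: "nat \<Rightarrow> bool list \<Rightarrow> bool" where
  "is_leaf N v \<longleftrightarrow> v \<in> full_tree N \<and> (\<forall>b. v @ [b] \<notin> full_tree N)"

(* The value X_v in the tree of depth N for the signs s.  Signs other than 1 and -1 are
   treated as -1 and paths outside the tree get the value 1; neither case matters below,
   since the signs are almost surely 1 or -1 and the recursion from a vertex of the tree
   stays in the tree. *)
function minplus_val :: "nat \<Rightarrow> (bool list \<Rightarrow> int) \<Rightarrow> bool list \<Rightarrow> nat" where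
  "minplus_val N s v =
     (if is_leaf N v \<or> v \<notin> full_tree N then 1
      else if s v = 1 then minplus_val N s (v @ [False]) + minplus_val N s (v @ [True])
      else min (minplus_val N s (v @ [False])) (minplus_val N s (v @ [True])))"
  by pat_completeness auto
termination
  by (relation "Wellfounded.measure (\<lambda>(N, s, v). N - length v)") (auto simp: full_tree_def)

declare minplus_val.simps [simp del]

definition root_val :: "nat \<Rightarrow> (bool list \<Rightarrow> int) \<Rightarrow> nat" where
  "root_val N s = minplus_val N s []"

(* The random variables X n may live on different probability spaces M n. *)
definition converges_in_distribution ::
  "(nat \<Rightarrow> 'a measure) \<Rightarrow> (nat \<Rightarrow> 'a \<Rightarrow> real) \<Rightarrow> 'b measure \<Rightarrow> ('b \<Rightarrow> real) \<Rightarrow> bool" where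
  "converges_in_distribution M X L Y \<longleftrightarrow>
     weak_conv_m (\<lambda>n. distr (M n) borel (X n)) (distr L borel Y)"

definition nontrivial_rv :: "'b measure \<Rightarrow> ('b \<Rightarrow> real) \<Rightarrow> bool" where
  "nontrivial_rv L Y \<longleftrightarrow> \<not> (\<exists>c. AE \<omega> in L. Y \<omega> = c)"

end

theory Submission
  imports Defs
begin

text \<open>
  Replacing the leaves of the tree by larger values only increases the root, so \<open>X\<^sub>N\<close> is
  stochastically increasing in \<open>N\<close> and each tail \<open>P (X\<^sub>N \<ge> k)\<close> has a limit \<open>A k\<close>.  What remains
  is to see that no mass escapes to infinity.  A sum that reaches \<open>2 k\<close> has a summand that
  reaches \<open>k\<close>, hence
  \<open>A (2 k) \<le> p (1 - (1 - A k)\<^sup>2) + (1 - p) (A (2 k))\<^sup>2\<close>, and \<open>q = lim A k\<close> satisfies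
  \<open>(1 - 2 p) q \<le> (1 - 2 p) q\<^sup>2\<close>.  As \<open>p < 1/2\<close>, either \<open>q = 0\<close> or \<open>q \<ge> 1\<close>; the latter is excluded by
  \<open>A 2 \<le> p / (1 - p) < 1\<close>, where \<open>p / (1 - p)\<close> is the smaller fixed point of the recursion
  \<open>t \<mapsto> p + (1 - p) t\<^sup>2\<close> for \<open>P (X\<^sub>N \<ge> 2)\<close>.
\<close>

section \<open>The law of the root value\<close>

text \<open>The index is shifted: this is the law of the root value at depth \<open>n + 1\<close>,
  as \<open>distr_minplus_val\<close> shows. Independence of the sign and the two subtrees becomes
  \<open>pair_pmf\<close>, and \<open>True\<close> codes the sign 1.\<close>

primrec minplus_pmf :: "real \<Rightarrow> nat \<Rightarrow> nat pmf" where
  "minplus_pmf p 0 = return_pmf 1"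
| "minplus_pmf p (Suc n) =
     map_pmf (\<lambda>(b, x, y). if b then x + y else min x y)
       (pair_pmf (bernoulli_pmf p) (pair_pmf (minplus_pmf p n) (minplus_pmf p n)))"

text \<open>Stochastic order is expressed by couplings. Couple the two children independently and
  use one common sign: sum and minimum are both monotone, so the parents are ordered too.\<close>

lemma rel_pmf_minplus_step:
  fixes q r :: "nat pmf"
  assumes "rel_pmf (\<le>) q r"
  shows "rel_pmf (\<le>)
    (map_pmf (\<lambda>(b, x, y). if b then x + y else min x y) (pair_pmf s (pair_pmf q q)))
    (map_pmf (\<lambda>(b, x, y). if b then x + y else min x y) (pair_pmf s (pair_pmf r r)))"
proof -
  have "rel_pmf (rel_prod (=) (rel_prod (\<le>) (\<le>))) (pair_pmf s (pair_pmf q q)) (pair_pmf s (pair_pmf r r))"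
    using assms by (simp add: rel_pmf_rel_prod pmf.rel_eq)
  then show ?thesis
    unfolding pmf.rel_map by (rule pmf.rel_mono_strong) auto
qed

lemma rel_pmf_minplus_Suc: "rel_pmf (\<le>) (minplus_pmf p n) (minplus_pmf p (Suc n))"
proof (induction n)
  case 0
  show ?case
    unfolding minplus_pmf.simps rel_pmf_return_pmf1 by (auto split: if_splits)
next
  case (Suc n)
  then show ?case
    using rel_pmf_minplus_step[OF Suc] by (simp only: minplus_pmf.simps)
qed

section \<open>Recursions and bounds for the tails\<close>

lemma tail_minplus_mono:
  "measure_pmf.prob (minplus_pmf p n) {k..} \<le> measure_pmf.prob (minplus_pmf p (Suc n)) {k..}"
proof -
  have "measure_pmf.prob (minplus_pmf p n) {k..}
      \<le> measure_pmf.prob (minplus_pmf p (Suc n)) {y. \<exists>x\<in>{k..}. x \<le> y}"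
    by (rule rel_pmf_measureD[OF rel_pmf_minplus_Suc])
  also have "{y. \<exists>x\<in>{k..}. x \<le> y} = {k..}" by auto
  finally show ?thesis .
qed

lemma tail_minplus_1: "measure_pmf.prob (minplus_pmf p n) {1..} = 1"
proof -
  have "set_pmf (minplus_pmf p n) \<subseteq> {1..}"
    by (induction n) force+
  then show ?thesis
    by (intro measure_pmf.prob_eq_1[THEN iffD2]) (auto simp: AE_measure_pmf_iff)
qed

lemma prob_pair_bernoulli:
  assumes "0 \<le> p" "p \<le> 1"
  shows "measure_pmf.prob (pair_pmf (bernoulli_pmf p) q) E
    = p * measure_pmf.prob q {z. (True, z) \<in> E} + (1 - p) * measure_pmf.prob q {z. (False, z) \<in> E}"
proof -
  have "emeasure (pair_pmf (bernoulli_pmf p) q) E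
    = (\<integral>\<^sup>+b. emeasure q {z. (b, z) \<in> E} \<partial>bernoulli_pmf p)"
    by (simp add: pair_pmf_def indicator_def vimage_def
        nn_integral_indicator[symmetric] del: nn_integral_bernoulli_pmf)
  also have "\<dots> = ennreal (p * measure_pmf.prob q {z. (True, z) \<in> E}
      + (1 - p) * measure_pmf.prob q {z. (False, z) \<in> E})"
    using assms by (simp add: measure_pmf.emeasure_eq_measure ennreal_mult ennreal_plus mult.commute)
  finally show ?thesis
    using assms by (subst (asm) measure_pmf.emeasure_eq_measure, subst (asm) ennreal_inj) auto
qed

lemma tail_minplus_Suc:
  assumes "0 \<le> p" "p \<le> 1"
  shows "measure_pmf.prob (minplus_pmf p (Suc n)) {k..} =
    p * measure_pmf.prob (pair_pmf (minplus_pmf p n) (minplus_pmf p n)) {(x, y). k \<le> x + y} +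
    (1 - p) * (measure_pmf.prob (minplus_pmf p n) {k..})\<^sup>2"
proof -
  let ?q = "minplus_pmf p n"
  have "measure_pmf.prob (pair_pmf ?q ?q) {(x, y). k \<le> min x y}
      = measure_pmf.prob (pair_pmf ?q ?q) ({k..} \<times> {k..})"
    by (rule arg_cong[where f="measure_pmf.prob _"]) auto
  also have "\<dots> = (measure_pmf.prob ?q {k..})\<^sup>2"
    by (simp add: measure_pmf_prob_product power2_eq_square)
  finally show ?thesis
    using assms by (simp add: prob_pair_bernoulli vimage_def case_prod_beta')
qed

text \<open>If both children are below \<open>k\<close>, their sum is below \<open>2 * k\<close>.
  Passing to this complement replaces the law of the sum by tails at \<open>k\<close> alone, which
  makes the inequality closed under limits.\<close>

lemma tail_minplus_double:
  assumes "0 \<le> p" "p \<le> 1"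
  shows "measure_pmf.prob (minplus_pmf p (Suc n)) {2 * k..} \<le>
    p * (1 - (1 - measure_pmf.prob (minplus_pmf p n) {k..})\<^sup>2) +
    (1 - p) * (measure_pmf.prob (minplus_pmf p n) {2 * k..})\<^sup>2"
proof -
  let ?q = "minplus_pmf p n"
  have lt: "measure_pmf.prob ?q {..<k} = 1 - measure_pmf.prob ?q {k..}"
    using measure_pmf.prob_compl[of "{k..}" ?q] by (simp add: Compl_eq_Diff_UNIV[symmetric] Compl_atLeast)
  have "measure_pmf.prob (pair_pmf ?q ?q) {(x, y). 2 * k \<le> x + y}
      \<le> measure_pmf.prob (pair_pmf ?q ?q) (UNIV - {..<k} \<times> {..<k})"
    by (intro measure_pmf.finite_measure_mono) auto
  also have "\<dots> = 1 - (1 - measure_pmf.prob ?q {k..})\<^sup>2"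
    using measure_pmf.prob_compl[of "{..<k} \<times> {..<k}" "pair_pmf ?q ?q"]
    by (simp add: measure_pmf_prob_product power2_eq_square lt)
  finally show ?thesis
    unfolding tail_minplus_Suc[OF assms] using assms by (simp add: mult_left_mono)
qed

text \<open>All values are at least 1, so a sum always reaches 2; a minimum does so exactly when
  both children do.\<close>

lemma tail_minplus_2_Suc:
  assumes "0 \<le> p" "p \<le> 1"
  shows "measure_pmf.prob (minplus_pmf p (Suc n)) {2..} =
    p + (1 - p) * (measure_pmf.prob (minplus_pmf p n) {2..})\<^sup>2"
proof -
  let ?q = "minplus_pmf p n"
  have "1 = measure_pmf.prob (pair_pmf ?q ?q) ({1..} \<times> {1..})"
    by (simp only: measure_pmf_prob_product countable_subset[OF subset_UNIV] countableI_type
        tail_minplus_1)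
  also have "\<dots> \<le> measure_pmf.prob (pair_pmf ?q ?q) {(x, y). 2 \<le> x + y}"
    by (intro measure_pmf.finite_measure_mono) auto
  finally have "measure_pmf.prob (pair_pmf ?q ?q) {(x, y). 2 \<le> x + y} = 1"
    by (simp add: antisym)
  then show ?thesis
    by (simp add: tail_minplus_Suc[OF assms] del: minplus_pmf.simps)
qed

text \<open>The tail at 2 starts from 0 and evolves by a map increasing on the nonnegative reals, so
  it cannot pass a fixed point of that map.\<close>

lemma tail_minplus_2_le:
  assumes "0 \<le> p" "p < 1"
  shows "measure_pmf.prob (minplus_pmf p n) {2..} \<le> p / (1 - p)"
proof (induction n)
  case (Suc n)
  have "(measure_pmf.prob (minplus_pmf p n) {2..})\<^sup>2 \<le> (p / (1 - p))\<^sup>2"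
    by (intro power_mono Suc) auto
  then have "p + (1 - p) * (measure_pmf.prob (minplus_pmf p n) {2..})\<^sup>2
      \<le> p + (1 - p) * (p / (1 - p))\<^sup>2"
    using assms by (simp add: mult_left_mono)
  also have "\<dots> = p / (1 - p)"
    using assms by (simp add: power2_eq_square add_divide_eq_iff) (simp add: algebra_simps)
  finally show ?case
    using assms by (simp add: tail_minplus_2_Suc del: minplus_pmf.simps)
qed (use assms in simp)

section \<open>Passage to the limit\<close>

text \<open>The differences of \<open>A\<close> serve as point masses. They telescope, and
  \<open>A\<close> tending to 0 makes their total mass 1.\<close>

lemma ex_pmf_with_tails:
  fixes A :: "nat \<Rightarrow> real"
  assumes "antimono A" "A 0 = 1" "A \<longlonglongrightarrow> 0"
  shows "\<exists>q. \<forall>k. measure_pmf.prob q {k..} = A k"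
proof -
  define f where "f k = A k - A (Suc k)" for k
  have f_nonneg: "0 \<le> f k" for k
    using antimonoD[OF assms(1), of k "Suc k"] by (simp add: f_def)
  have "f sums (A 0 - 0)"
    unfolding f_def by (rule telescope_sums'[OF assms(3)])
  then have "f sums 1"
    by (simp add: assms(2))
  then have total: "(\<integral>\<^sup>+k. ennreal (f k) \<partial>count_space UNIV) = 1"
    using f_nonneg by (simp add: nn_integral_count_space_nat suminf_ennreal2 sums_iff)
  have "measure_pmf.prob (embed_pmf f) {k..} = A k" for k
  proof -
    \<comment> \<open>The complement of the tail is finite, so its mass is a finite telescoping
      sum.\<close>
    have "measure_pmf.prob (embed_pmf f) {..<k} = (\<Sum>j<k. f j)"
      by (simp add: measure_measure_pmf_finite pmf_embed_pmf[OF f_nonneg total])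
    also have "\<dots> = 1 - A k"
      by (simp add: f_def sum_lessThan_telescope' assms(2))
    finally show ?thesis
      using measure_pmf.prob_compl[of "{..<k}" "embed_pmf f"]
      by (simp add: Compl_eq_Diff_UNIV[symmetric] Compl_lessThan)
  qed
  then show ?thesis by blast
qed

text \<open>The two bounds at 2 are kept for non-triviality: for \<open>p > 0\<close> they place
  this tail strictly between 0 and 1.\<close>

theorem ex_limit_minplus_pmf:
  assumes "0 \<le> p" "p < 1/2"
  shows "\<exists>q. (\<forall>k. (\<lambda>n. measure_pmf.prob (minplus_pmf p n) {k..}) \<longlonglongrightarrow> measure_pmf.prob q {k..}) \<and>
    p \<le> measure_pmf.prob q {2..} \<and> measure_pmf.prob q {2..} < 1"
proof -
  let ?T = "\<lambda>n k. measure_pmf.prob (minplus_pmf p n) {k..}"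
  have p1: "p \<le> 1" "p < 1" using assms by auto
  define A where "A k = lim (\<lambda>n. ?T n k)" for k
  have lim: "(\<lambda>n. ?T n k) \<longlonglongrightarrow> A k" for k
  proof -
    have "incseq (\<lambda>n. ?T n k)"
      by (rule incseq_SucI) (rule tail_minplus_mono)
    then have "convergent (\<lambda>n. ?T n k)"
      by (intro Bseq_monoseq_convergent BseqI'[of _ 1]) (auto simp: incseq_imp_monoseq)
    then show ?thesis
      by (simp add: A_def convergent_LIMSEQ_iff)
  qed
  have nonneg: "0 \<le> A k" for k
    by (rule LIMSEQ_le_const[OF lim]) auto
  have A0: "A 0 = 1"
    using LIMSEQ_unique[OF lim[of 0]] by (simp add: atLeast_0 del: minplus_pmf.simps)
  have anti: "antimono A"
  proof (rule antimonoI)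
    fix j k :: nat assume "j \<le> k"
    then show "A k \<le> A j"
      by (intro LIMSEQ_le[OF lim lim] exI[of _ 0] allI impI measure_pmf.finite_measure_mono) auto
  qed
  have A2_le: "A 2 \<le> p / (1 - p)"
    using tail_minplus_2_le[OF assms(1) p1(2)] by (intro LIMSEQ_le_const2[OF lim]) auto
  also have "\<dots> < 1"
    using assms by (simp add: field_simps)
  finally have A2_lt: "A 2 < 1" .
  have A2_ge: "p \<le> A 2"
  proof -
    \<comment> \<open>At \<open>n = 0\<close> this tail is 0, so the bound is taken from the
      successor on.\<close>
    have "p \<le> ?T (Suc n) 2" for n
      using p1 by (simp add: tail_minplus_2_Suc[OF assms(1) p1(1)] del: minplus_pmf.simps)
    then show ?thesis
      using LIMSEQ_le_const[OF LIMSEQ_Suc[OF lim]] by blast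
  qed
  have double: "A (2 * k) \<le> p * (1 - (1 - A k)\<^sup>2) + (1 - p) * (A (2 * k))\<^sup>2" for k
  proof (rule LIMSEQ_le)
    show "(\<lambda>n. ?T (Suc n) (2 * k)) \<longlonglongrightarrow> A (2 * k)"
      by (rule LIMSEQ_Suc[OF lim])
    show "(\<lambda>n. p * (1 - (1 - ?T n k)\<^sup>2) + (1 - p) * (?T n (2 * k))\<^sup>2)
        \<longlonglongrightarrow> p * (1 - (1 - A k)\<^sup>2) + (1 - p) * (A (2 * k))\<^sup>2"
      by (intro tendsto_intros lim)
  qed (use tail_minplus_double[OF assms(1) p1(1)] in blast)
  obtain q where q: "A \<longlonglongrightarrow> q"
    using decseq_convergent[OF anti, of 0] nonneg by blast
  have q_le: "q \<le> A 2"
    by (rule decseq_ge[OF anti q])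
  have q_nonneg: "0 \<le> q"
    by (rule LIMSEQ_le_const[OF q]) (use nonneg in auto)
  \<comment> \<open>Along even indices the limit is the same, so \<open>double\<close> turns into an
    inequality in \<open>q\<close> alone.\<close>
  have q2: "(\<lambda>k. A (2 * k)) \<longlonglongrightarrow> q"
    using LIMSEQ_subseq_LIMSEQ[OF q, of "\<lambda>k. 2 * k"] by (simp add: strict_mono_def comp_def)
  have "q \<le> p * (1 - (1 - q)\<^sup>2) + (1 - p) * q\<^sup>2"
  proof (rule LIMSEQ_le[OF q2])
    show "(\<lambda>k. p * (1 - (1 - A k)\<^sup>2) + (1 - p) * (A (2 * k))\<^sup>2)
        \<longlonglongrightarrow> p * (1 - (1 - q)\<^sup>2) + (1 - p) * q\<^sup>2"
      by (intro tendsto_intros q q2)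
  qed (use double in blast)
  then have "0 \<le> ((1 - 2 * p) * q) * (q - 1)"
    by (simp add: algebra_simps power2_eq_square)
  moreover have "q - 1 < 0"
    using q_le A2_lt by simp
  ultimately have "(1 - 2 * p) * q \<le> 0"
    by (simp add: zero_le_mult_iff)
  then have "q = 0"
    using assms q_nonneg by (simp add: mult_le_0_iff)
  then obtain r where "\<And>k. measure_pmf.prob r {k..} = A k"
    using ex_pmf_with_tails[OF anti A0] q by auto
  then show ?thesis
    using lim A2_ge A2_lt by (intro exI[of _ r]) simp
qed

section \<open>The signed tree\<close>

definition subtree :: "nat \<Rightarrow> bool list \<Rightarrow> bool list set" where
  "subtree N v = {w \<in> full_tree N. \<exists>u. w = v @ u}"

lemma finite_full_tree: "finite (full_tree N)"
proof -
  have "full_tree N \<subseteq> {v. set v \<subseteq> UNIV \<and> length v \<le> N}"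
    by (auto simp: full_tree_def)
  then show ?thesis
    by (rule finite_subset) (rule finite_lists_length_le[OF finite])
qed

lemma subtree_subset: "subtree N v \<subseteq> full_tree N"
  by (auto simp: subtree_def)

text \<open>Values depend only on signs in their own subtree; since sibling subtrees are disjoint,
  this makes the values of the two children independent.\<close>

lemma minplus_val_cong:
  assumes "\<And>w. w \<in> subtree N v \<Longrightarrow> s w = t w"
  shows "minplus_val N s v = minplus_val N t v"
  using assms
proof (induction N s v rule: minplus_val.induct)
  case (1 N s v)
  show ?case
  proof (cases "is_leaf N v \<or> v \<notin> full_tree N")
    case True
    then show ?thesis
      by (simp add: minplus_val.simps)
  next
    case False
    then have "s v = t v"
      using 1(5) by (auto simp: subtree_def)
    moreover have "minplus_val N s (v @ [b]) = minplus_val N t (v @ [b])" for b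
    proof -
      have "s w = t w" if "w \<in> subtree N (v @ [b])" for w
        using that 1(5) by (auto simp: subtree_def)
      then show ?thesis
        using 1(1-4)[OF False] by (cases b; cases "s v = 1") auto
    qed
    ultimately show ?thesis
      by (subst (1 2) minplus_val.simps) simp
  qed
qed

text \<open>Induction on the height: the condition on \<open>length v\<close> says that the subtree
  at \<open>v\<close> has depth \<open>n + 1\<close>. Measurability is carried along so that the law
  of the children is meaningful in the step.\<close>

lemma (in prob_space) distr_minplus_val:
  assumes p: "0 \<le> p" "p \<le> 1"
    and indep: "indep_vars (\<lambda>_. count_space UNIV) X (full_tree N)"
    and prob_X: "\<And>v. v \<in> full_tree N \<Longrightarrow> prob {\<omega> \<in> space M. X v \<omega> = (1 :: int)} = p"
    and "length v + Suc n = N"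
  shows "(\<lambda>\<omega>. minplus_val N (\<lambda>w. X w \<omega>) v) \<in> measurable M (count_space UNIV) \<and>
    distr M (count_space UNIV) (\<lambda>\<omega>. minplus_val N (\<lambda>w. X w \<omega>) v) = measure_pmf (minplus_pmf p n)"
  using assms(5)
proof (induction n arbitrary: v)
  case 0
  then have "minplus_val N (\<lambda>w. X w \<omega>) v = 1" for \<omega>
    by (subst minplus_val.simps) (auto simp: is_leaf_def full_tree_def)
  then show ?case
    by (auto simp: return_pmf.rep_eq intro!: measure_eqI simp: emeasure_distr emeasure_space_1
        split: split_indicator)
next
  case (Suc n)
  let ?val = "\<lambda>v \<omega>. minplus_val N (\<lambda>w. X w \<omega>) v"
  let ?q = "minplus_pmf p n"
  have v: "v \<in> full_tree N"
    using Suc.prems by (auto simp: full_tree_def)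
  define K where "K j = (case j of None \<Rightarrow> {v} | Some b \<Rightarrow> subtree N (v @ [b]))" for j
  \<comment> \<open>The sign at \<open>v\<close> and the values at its children, as functions on disjoint sets of vertices;
      the sign is coded in \<open>nat\<close> because independent families have a single value type.\<close>
  define F where "F j s = (case j of None \<Rightarrow> of_bool (s v = 1) | Some b \<Rightarrow> minplus_val N s (v @ [b]))"
    for j and s :: "bool list \<Rightarrow> int"
  have K_sub: "K j \<subseteq> full_tree N" for j
    using v subtree_subset by (auto simp: K_def split: option.splits)
  have "indep_vars (\<lambda>j. PiM (K j) (\<lambda>_. count_space UNIV)) (\<lambda>j \<omega>. restrict (\<lambda>w. X w \<omega>) (K j)) UNIV"
    using K_sub by (intro indep_vars_restrict[OF indep])
      (auto simp: disjoint_family_on_def K_def subtree_def split: option.splits)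
  \<comment> \<open>A finite product of discrete spaces of this countable type is discrete, so every
    function on it is measurable.\<close>
  moreover have "F j \<in> measurable (PiM (K j) (\<lambda>_. count_space UNIV)) (count_space UNIV)" for j
    using finite_subset[OF K_sub finite_full_tree] by (subst count_space_PiM_finite) auto
  ultimately have "indep_vars (\<lambda>_. count_space UNIV) (\<lambda>j \<omega>. F j (restrict (\<lambda>w. X w \<omega>) (K j))) UNIV"
    by (rule indep_vars_compose2)
  moreover have "F j (restrict s (K j)) = F j s" for j s
    by (auto simp: F_def K_def split: option.splits intro: minplus_val_cong)
  ultimately have ind: "indep_vars (\<lambda>_. count_space UNIV) (\<lambda>j \<omega>. F j (\<lambda>w. X w \<omega>)) UNIV"
    by simp
  have meas_X: "X v \<in> measurable M (count_space UNIV)"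
    using indep v by (auto simp: indep_vars_def)
  have IH: "?val (v @ [b]) \<in> measurable M (count_space UNIV)"
    "distr M (count_space UNIV) (?val (v @ [b])) = measure_pmf ?q" for b
    using Suc.IH[of "v @ [b]"] Suc.prems by auto
  note [measurable] = meas_X IH(1)
  have prob_val: "prob {\<omega> \<in> space M. ?val (v @ [b]) \<omega> = x} = pmf ?q x" for b x
  proof -
    have "pmf ?q x = measure (distr M (count_space UNIV) (?val (v @ [b]))) {x}"
      by (simp add: IH(2) measure_pmf_single)
    also have "\<dots> = prob {\<omega> \<in> space M. ?val (v @ [b]) \<omega> = x}"
      by (subst measure_distr) (auto intro!: arg_cong[where f=prob])
    finally show ?thesis by simp
  qed
  have prob_sign: "prob {\<omega> \<in> space M. (X v \<omega> = 1) = b} = pmf (bernoulli_pmf p) b" for b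
  proof (cases b)
    case True
    then show ?thesis using prob_X[OF v] p by simp
  next
    case False
    have "prob {\<omega> \<in> space M. \<not> X v \<omega> = 1} = 1 - p"
      using prob_X[OF v] by (subst prob_neg) auto
    then show ?thesis using False p by simp
  qed
  define Z where "Z \<omega> = (X v \<omega> = 1, ?val (v @ [False]) \<omega>, ?val (v @ [True]) \<omega>)" for \<omega>
  have meas_Z [measurable]: "Z \<in> measurable M (count_space UNIV)"
    unfolding Z_def by measurable
  have distr_Z: "distr M (count_space UNIV) Z = measure_pmf (pair_pmf (bernoulli_pmf p) (pair_pmf ?q ?q))"
  proof (rule measure_eqI_countable[where A=UNIV])
    fix z :: "bool \<times> nat \<times> nat"
    obtain b x y where z: "z = (b, x, y)" by (cases z)
    let ?B = "\<lambda>j. case j of None \<Rightarrow> {of_bool b} | Some c \<Rightarrow> {if c then y else x}"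
    have UNIV_opt: "(UNIV :: bool option set) = {None, Some False, Some True}"
      by (auto simp: UNIV_option_conv UNIV_bool)
    have vimage_F: "(\<lambda>\<omega>. F j (\<lambda>w. X w \<omega>)) -` ?B j \<inter> space M = (case j of
        None \<Rightarrow> {\<omega> \<in> space M. (X v \<omega> = 1) = b}
      | Some c \<Rightarrow> {\<omega> \<in> space M. ?val (v @ [c]) \<omega> = (if c then y else x)})" for j
      by (auto simp: F_def of_bool_def split: option.splits if_splits)
    \<comment> \<open>On a countable type point masses determine the law, and each event
      \<open>Z = z\<close> is an intersection of three events, one for each member of the
      independent family.\<close>
    have "Z -` {z} \<inter> space M = (\<Inter>j\<in>UNIV. (\<lambda>\<omega>. F j (\<lambda>w. X w \<omega>)) -` ?B j \<inter> space M)"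
      by (auto simp: UNIV_opt Z_def z F_def of_bool_def split: if_splits)
    then have "prob (Z -` {z} \<inter> space M)
        = (\<Prod>j\<in>UNIV. prob ((\<lambda>\<omega>. F j (\<lambda>w. X w \<omega>)) -` ?B j \<inter> space M))"
      by (simp only:) (rule indep_varsD_finite[OF ind], auto)
    also have "\<dots> = prob {\<omega> \<in> space M. (X v \<omega> = 1) = b} *
        (prob {\<omega> \<in> space M. ?val (v @ [False]) \<omega> = x} * prob {\<omega> \<in> space M. ?val (v @ [True]) \<omega> = y})"
      by (simp add: UNIV_opt vimage_F)
    also have "\<dots> = pmf (pair_pmf (bernoulli_pmf p) (pair_pmf ?q ?q)) z"
      by (simp only: prob_sign prob_val z pmf_pair)
    finally show "emeasure (distr M (count_space UNIV) Z) {z}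
        = emeasure (measure_pmf (pair_pmf (bernoulli_pmf p) (pair_pmf ?q ?q))) {z}"
      by (simp add: emeasure_distr emeasure_eq_measure emeasure_pmf_single)
  qed auto
  let ?g = "\<lambda>(b, x, y). if b then x + y else min x y"
  have val: "?val v = (\<lambda>\<omega>. ?g (Z \<omega>))"
    using Suc.prems
    by (subst minplus_val.simps) (auto simp: Z_def is_leaf_def full_tree_def fun_eq_iff)
  have "distr M (count_space UNIV) (\<lambda>\<omega>. ?g (Z \<omega>))
      = distr (distr M (count_space UNIV) Z) (count_space UNIV) ?g"
    by (subst distr_distr) (auto simp: comp_def)
  also have "\<dots> = measure_pmf (minplus_pmf p (Suc n))"
    by (simp add: distr_Z map_pmf_rep_eq)
  finally show ?case
    unfolding val by (auto intro: measurable_compose[OF meas_Z])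
qed

section \<open>Distribution functions, non-triviality and the conclusion\<close>

lemma cdf_map_pmf_real:
  "cdf (map_pmf real q) x = (if x < 0 then 0 else 1 - measure_pmf.prob q {Suc (nat \<lfloor>x\<rfloor>)..})"
proof (cases "x < 0")
  case True
  then have "real -` {..x} = {}"
    by (auto simp: not_le intro: less_le_trans)
  then show ?thesis
    using True by (simp add: cdf_def)
next
  case False
  \<comment> \<open>A natural number exceeds \<open>x\<close> exactly when it reaches
    \<open>Suc (nat \<lfloor>x\<rfloor>)\<close>. Each value of the distribution function is thus
    the complement of a single tail.\<close>
  then have "real -` {..x} = UNIV - {Suc (nat \<lfloor>x\<rfloor>)..}"
    by (auto simp: not_le Suc_le_eq less_Suc_eq_le le_nat_iff nat_less_iff floor_less_iff le_floor_iff)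
  then show ?thesis
    using False measure_pmf.prob_compl[of "{Suc (nat \<lfloor>x\<rfloor>)..}" q] by (simp add: cdf_def)
qed

text \<open>A constant \<open>c\<close> would force the tail at \<open>k\<close> to be 1 or 0,
  according to whether \<open>c\<close> reaches \<open>k\<close>.\<close>

lemma nontrivial_rv_map_pmf_real:
  assumes "0 < measure_pmf.prob q {k..}" "measure_pmf.prob q {k..} < 1"
  shows "nontrivial_rv (measure_pmf (map_pmf real q)) (\<lambda>x. x)"
  unfolding nontrivial_rv_def
proof
  assume "\<exists>c. AE x in map_pmf real q. x = c"
  then obtain c where c: "\<And>m. m \<in> set_pmf q \<Longrightarrow> real m = c"
    by (auto simp: AE_measure_pmf_iff)
  show False
  proof (cases "c \<ge> real k")
    case True
    then have "AE m in q. m \<in> {k..}"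
      using c by (force simp: AE_measure_pmf_iff)
    then show False
      using assms(2) measure_pmf.prob_eq_1[of "{k..}" q] by simp
  next
    case False
    then have "set_pmf q \<inter> {k..} = {}"
      using c by force
    then show False
      using assms(1) by (simp add: measure_pmf_zero_iff[symmetric])
  qed
qed

theorem theorem2:
  fixes p :: real
    and M :: "nat \<Rightarrow> 'a measure"
    and \<eta> :: "nat \<Rightarrow> bool list \<Rightarrow> 'a \<Rightarrow> int"
  assumes "0 \<le> p" and "p < 1/2"
    and "\<And>N. N \<ge> 1 \<Longrightarrow> prob_space (M N)"
    and "\<And>N. N \<ge> 1 \<Longrightarrow>
           prob_space.indep_vars (M N) (\<lambda>_. count_space UNIV) (\<eta> N) (full_tree N)"
    and "\<And>N v. N \<ge> 1 \<Longrightarrow> v \<in> full_tree N \<Longrightarrow>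
           measure (M N) {\<omega> \<in> space (M N). \<eta> N v \<omega> = 1} = p"
    and "\<And>N v. N \<ge> 1 \<Longrightarrow> v \<in> full_tree N \<Longrightarrow>
           measure (M N) {\<omega> \<in> space (M N). \<eta> N v \<omega> = -1} = 1 - p"
  shows "\<exists>(L :: real measure) Y. prob_space L \<and> Y \<in> borel_measurable L \<and>
           converges_in_distribution M (\<lambda>N \<omega>. real (root_val N (\<lambda>v. \<eta> N v \<omega>))) L Y \<and>
           (0 < p \<longrightarrow> nontrivial_rv L Y)"
proof -
  let ?X = "\<lambda>N \<omega>. root_val N (\<lambda>v. \<eta> N v \<omega>)"
  obtain q where lim: "\<And>k. (\<lambda>n. measure_pmf.prob (minplus_pmf p n) {k..}) \<longlonglongrightarrow> measure_pmf.prob q {k..}"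
    and q2: "p \<le> measure_pmf.prob q {2..}" "measure_pmf.prob q {2..} < 1"
    using ex_limit_minplus_pmf[OF assms(1,2)] by blast
  have cdf_X: "cdf (distr (M (Suc n)) borel (\<lambda>\<omega>. real (?X (Suc n) \<omega>))) x
      = cdf (map_pmf real (minplus_pmf p n)) x" for n x
  proof -
    interpret prob_space "M (Suc n)"
      using assms(3) by simp
    have X: "?X (Suc n) \<in> measurable (M (Suc n)) (count_space UNIV)"
      "distr (M (Suc n)) (count_space UNIV) (?X (Suc n)) = measure_pmf (minplus_pmf p n)"
      using distr_minplus_val[of p "\<eta> (Suc n)" "Suc n" "[]" n] assms(1,2,4,5)
      unfolding root_val_def by auto
    have "distr (M (Suc n)) borel (\<lambda>\<omega>. real (?X (Suc n) \<omega>))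
        = distr (distr (M (Suc n)) (count_space UNIV) (?X (Suc n))) borel real"
      using X(1) by (subst distr_distr) (auto simp: comp_def)
    then show ?thesis
      by (simp add: X(2) cdf_def measure_distr)
  qed
  \<comment> \<open>The shift to \<open>Suc n\<close> skips depth 0, where nothing is assumed about
    \<open>M\<close>. Convergence of tails gives convergence at every \<open>x\<close>, not only at
    continuity points.\<close>
  have "(\<lambda>N. cdf (distr (M N) borel (\<lambda>\<omega>. real (?X N \<omega>))) x) \<longlonglongrightarrow> cdf (map_pmf real q) x" for x
    by (rule LIMSEQ_imp_Suc, unfold cdf_X cdf_map_pmf_real) (auto intro!: tendsto_intros lim)
  moreover have "cdf (distr (map_pmf real q) borel (\<lambda>x. x)) = cdf (map_pmf real q)"
    by (auto simp: cdf_def measure_distr)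
  ultimately have "converges_in_distribution M (\<lambda>N \<omega>. real (?X N \<omega>)) (map_pmf real q) (\<lambda>x. x)"
    by (simp add: converges_in_distribution_def weak_conv_m_def weak_conv_def)
  moreover have "nontrivial_rv (map_pmf real q) (\<lambda>x. x)" if "0 < p"
    using that q2 by (intro nontrivial_rv_map_pmf_real[of q 2]) auto
  ultimately show ?thesis
    using prob_space_measure_pmf[of "map_pmf real q"]
    by (intro exI[of _ "measure_pmf (map_pmf real q)"] exI[of _ "\<lambda>x. x"]) auto
qed

end
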